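(* Let $r$, $s$, and $n$ be integers satisfying $1<r$, $1<s$, $r\le n$, $s\le n$, and $n<r+s$. Let $G$ be a graph containing an $s$-clique $A$ and an $r$-clique $B$ with $A$ and $B$ disjoint, such that each vertex in $B$ is adjacent to at least $j$ vertices in $A$. Then \[ N(G,n)\le \left\lfloor\frac{r(s-j)}{r+s-n}\right\rfloor. \]
   Context: All graphs are finite simple graphs. An $r$-clique is a set of $r$ pairwise adjacent vertices. An $n$-coloring of a graph $G$ is a proper vertex coloring using at most $n$ colors. Two colorings $C_1,C_2$ of $G$ are orthogonal if whenever two distinct vertices share a color in $C_1$, they have distinct colors in $C_2$. $N(G,n)$ denotes the maximum size of a set of pairwise orthogonal $n$-colorings of $G$. *)

theory Defs
  imports Complex_Main "HOL-Library.Ramsey" "HOL-Library.FuncSet"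
begin

text \<open>
  Graphs are given by a vertex set \<open>V\<close> and a set \<open>E\<close> of two-element subsets of \<open>V\<close>,
  so that \<^const>\<open>clique\<close> from the Ramsey theory is the usual notion of
  pairwise adjacency.
\<close>

definition fin_simple_graph :: "'a set \<Rightarrow> 'a set set \<Rightarrow> bool" where
  "fin_simple_graph V E \<longleftrightarrow> finite V \<and> E \<subseteq> [V]\<^bsup>2\<^esup>"

text \<open>
  The palette is \<open>{..<n}\<close>; not every colour has to be used. Colourings are
  extensional (\<open>\<rightarrow>\<^sub>E\<close>), so that two colourings that agree on \<open>V\<close> are equal and
  families of colourings are counted correctly.
\<close>

definition colorings :: "'a set \<Rightarrow> 'a set set \<Rightarrow> nat \<Rightarrow> ('a \<Rightarrow> nat) set" where
  "colorings V E n =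
     {c \<in> V \<rightarrow>\<^sub>E {..<n}. \<forall>u\<in>V. \<forall>v\<in>V. {u, v} \<in> E \<longrightarrow> c u \<noteq> c v}"

definition orthogonal_colorings :: "'a set \<Rightarrow> ('a \<Rightarrow> 'c) \<Rightarrow> ('a \<Rightarrow> 'c) \<Rightarrow> bool" where
  "orthogonal_colorings V c d \<longleftrightarrow>
     (\<forall>u\<in>V. \<forall>v\<in>V. u \<noteq> v \<and> c u = c v \<longrightarrow> d u \<noteq> d v)"

text \<open>
  The library's \<^const>\<open>pairwise\<close> only compares distinct members of the family.
  Two colourings that differ by a renaming of the colours count as distinct; they
  can be orthogonal only if both are injective on \<open>V\<close>, hence only if \<open>card V \<le> n\<close>.
\<close>

definition max_orthogonal :: "'a set \<Rightarrow> 'a set set \<Rightarrow> nat \<Rightarrow> nat" where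
  "max_orthogonal V E n =
     Max {card F | F. F \<subseteq> colorings V E n \<and> pairwise (orthogonal_colorings V) F}"

lemma finite_colorings: "finite V \<Longrightarrow> finite (colorings V E n)"
  unfolding colorings_def by (simp add: finite_PiE)

text \<open>The maximum is taken over a finite nonempty set, so it is attained.\<close>

lemma max_orthogonal_attained:
  assumes "finite V"
  shows "\<exists>F \<subseteq> colorings V E n. pairwise (orthogonal_colorings V) F \<and>
           card F = max_orthogonal V E n"
proof -
  let ?S = "{card F | F. F \<subseteq> colorings V E n \<and> pairwise (orthogonal_colorings V) F}"
  have "?S \<subseteq> card ` Pow (colorings V E n)" by blast
  then have "finite ?S"
    using finite_colorings[OF assms] by (meson finite_Pow_iff finite_imageI finite_subset)
  moreover have "?S \<noteq> {}"
    using pairwise_empty by blast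
  ultimately have "Max ?S \<in> ?S" by (rule Max_in)
  then show ?thesis unfolding max_orthogonal_def by auto
qed

end

(* Call a pair (b, a) in B \<times> A monochromatic in a colouring if a and b share a colour. A colouring
   with n colours is injective on A and on B, so at least r + s - n colours occur on both, and each
   of them gives a monochromatic pair. Monochromatic pairs are non-adjacent, so at most r (s - j)
   pairs are available, and orthogonal colourings have no monochromatic pair in common. *)
theory Submission
  imports Defs
begin

lemma coloring_inj_on_clique:
  assumes "c \<in> colorings V E n" and "K \<subseteq> V" and "clique K E"
  shows "inj_on c K"
  using assms unfolding colorings_def clique_def inj_on_def by blast

text \<open>Inclusion-exclusion in the palette: by injectivity the images of \<open>A\<close> and
  \<open>B\<close> have sizes \<open>card A\<close> and \<open>card B\<close>, and their union has
  at most \<open>n\<close> elements. The additive form avoids truncated subtraction.\<close>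

lemma card_monochromatic_pairs_ge:
  fixes c :: "'a \<Rightarrow> nat"
  assumes "finite A" and "finite B" and "inj_on c A" and "inj_on c B"
    and "c ` A \<subseteq> {..<n}" and "c ` B \<subseteq> {..<n}"
  shows "card A + card B \<le> n + card {p \<in> B \<times> A. c (fst p) = c (snd p)}"
proof -
  let ?S = "{p \<in> B \<times> A. c (fst p) = c (snd p)}"
  have "card (c ` A \<inter> c ` B) \<le> card ?S"
  proof (rule surj_card_le)
    show "finite ?S" using assms by simp
    \<comment> \<open>\<open>c \<circ> fst\<close> sends a monochromatic pair to its common colour,
      so every colour occurring on both sets is hit.\<close>
    show "c ` A \<inter> c ` B \<subseteq> (c \<circ> fst) ` ?S"
    proof
      fix k assume "k \<in> c ` A \<inter> c ` B"
      then obtain a b where "a \<in> A" "b \<in> B" "k = c a" "k = c b" by blast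
      then show "k \<in> (c \<circ> fst) ` ?S" by (intro image_eqI[of _ _ "(b, a)"]) auto
    qed
  qed
  moreover have "card (c ` A \<union> c ` B) \<le> n"
    using card_mono[of "{..<n}" "c ` A \<union> c ` B"] assms by simp
  moreover have "card (c ` A) + card (c ` B) = card (c ` A \<union> c ` B) + card (c ` A \<inter> c ` B)"
    using assms by (intro card_Un_Int) auto
  ultimately show ?thesis
    using assms by (simp add: card_image)
qed

text \<open>Each vertex of \<open>B\<close> misses at most \<open>card A - j\<close> vertices of
  \<open>A\<close>; summing over \<open>B\<close> gives the bound.\<close>

lemma card_nonadjacent_pairs_le:
  fixes E :: "'a set set"
  assumes "finite A" and "finite B" and "\<forall>b\<in>B. j \<le> card {a \<in> A. {a, b} \<in> E}"
  shows "card (SIGMA b:B. {a \<in> A. {a, b} \<notin> E}) \<le> card B * (card A - j)"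
proof -
  have "card {a \<in> A. {a, b} \<notin> E} \<le> card A - j" if "b \<in> B" for b
  proof -
    have "{a \<in> A. {a, b} \<notin> E} = A - {a \<in> A. {a, b} \<in> E}" by blast
    then have "card {a \<in> A. {a, b} \<notin> E} = card A - card {a \<in> A. {a, b} \<in> E}"
      using assms(1) by (simp add: card_Diff_subset)
    then show ?thesis using assms(3) that by (simp add: diff_le_mono2)
  qed
  then have "(\<Sum>b\<in>B. card {a \<in> A. {a, b} \<notin> E}) \<le> card B * (card A - j)"
    using sum_bounded_above[of B "\<lambda>b. card {a \<in> A. {a, b} \<notin> E}" "card A - j"] by simp
  then show ?thesis
    using assms by (simp add: card_SigmaI)
qed

text \<open>Double counting: the sets \<open>S c\<close> of monochromatic pairs are large, mutually
  disjoint and all contained in the set \<open>?N\<close> of non-adjacent pairs.\<close>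

lemma card_orthogonal_colorings_le:
  assumes "finite V" and F: "F \<subseteq> colorings V E n" "pairwise (orthogonal_colorings V) F"
    and A: "A \<subseteq> V" "clique A E" and B: "B \<subseteq> V" "clique B E" and disj: "A \<inter> B = {}"
    and deg: "\<forall>b\<in>B. j \<le> card {a \<in> A. {a, b} \<in> E}"
  shows "card F * (card A + card B - n) \<le> card B * (card A - j)"
proof -
  define S where "S c = {p \<in> B \<times> A. c (fst p) = c (snd p)}" for c :: "'a \<Rightarrow> nat"
  let ?N = "SIGMA b:B. {a \<in> A. {a, b} \<notin> E}"
  have fin: "finite A" "finite B" "finite F"
    using assms(1) A(1) B(1) F(1) finite_colorings finite_subset by blast+
  have fin_S: "finite (S c)" for c
    using fin unfolding S_def by simp
  have "card A + card B - n \<le> card (S c)" if "c \<in> F" for c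
  proof -
    have c: "c \<in> colorings V E n" using F(1) that by blast
    then have "c ` V \<subseteq> {..<n}" unfolding colorings_def by auto
    then have "c ` A \<subseteq> {..<n}" "c ` B \<subseteq> {..<n}" using A(1) B(1) by blast+
    with card_monochromatic_pairs_ge[OF fin(1,2)] coloring_inj_on_clique[OF c] A B
    show ?thesis unfolding S_def by (simp add: le_diff_conv add.commute)
  qed
  then have "card F * (card A + card B - n) \<le> (\<Sum>c\<in>F. card (S c))"
    using sum_bounded_below[of F "card A + card B - n" "\<lambda>c. card (S c)"] by simp
  also have "\<dots> = card (\<Union>c\<in>F. S c)"
  proof (rule card_UN_disjoint[symmetric])
    show "\<forall>c\<in>F. \<forall>d\<in>F. c \<noteq> d \<longrightarrow> S c \<inter> S d = {}"
    proof (intro ballI impI)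
      fix c d assume "c \<in> F" "d \<in> F" "c \<noteq> d"
      then have "orthogonal_colorings V c d" using F(2) by (simp add: pairwise_def)
      \<comment> \<open>A common pair would consist of two vertices, distinct because
        \<open>A\<close> and \<open>B\<close> are disjoint, that share a colour in both
        \<open>c\<close> and \<open>d\<close>.\<close>
      then show "S c \<inter> S d = {}"
        using A(1) B(1) disj unfolding S_def orthogonal_colorings_def by fastforce
    qed
  qed (use fin fin_S in auto)
  also have "\<dots> \<le> card ?N"
  proof (rule card_mono)
    show "finite ?N" using fin by simp
    \<comment> \<open>Colourings are proper, so the ends of an edge never form a monochromatic
      pair.\<close>
    show "(\<Union>c\<in>F. S c) \<subseteq> ?N"
      using F(1) A(1) B(1) unfolding S_def colorings_def by fastforce
  qed
  also have "\<dots> \<le> card B * (card A - j)"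
    using fin(1,2) deg by (rule card_nonadjacent_pairs_le)
  finally show ?thesis .
qed

theorem theorem1p2:
  fixes V :: "'a set" and E :: "'a set set"
    and A B :: "'a set"
    and r s n j :: nat
  assumes "1 < r" and "1 < s" and "r \<le> n" and "s \<le> n" and "n < r + s"
    and "fin_simple_graph V E"
    and "A \<subseteq> V" and "card A = s" and "clique A E"
    and "B \<subseteq> V" and "card B = r" and "clique B E"
    and "A \<inter> B = {}"
    and "\<forall>b\<in>B. j \<le> card {a \<in> A. {a, b} \<in> E}"
  shows "int (max_orthogonal V E n)
           \<le> \<lfloor>real r * (real s - real j) / (real r + real s - real n)\<rfloor>"
proof -
  have finV: "finite V"
    using assms(6) unfolding fin_simple_graph_def by simp
  then obtain F where F: "F \<subseteq> colorings V E n" "pairwise (orthogonal_colorings V) F"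
    and cardF: "card F = max_orthogonal V E n"
    using max_orthogonal_attained by blast
  have bound: "card F * (s + r - n) \<le> r * (s - j)"
    using card_orthogonal_colorings_le[OF finV F assms(7,9,10,12,13,14)] assms(8,11) by simp
  \<comment> \<open>This makes the truncated difference \<open>s - j\<close> agree with the real
    one. Since \<open>1 < r\<close>, there is a vertex in \<open>B\<close>, and its neighbours in
    \<open>A\<close> number at least \<open>j\<close> and at most \<open>s\<close>.\<close>
  have "j \<le> s"
  proof -
    obtain b where "b \<in> B" using assms(1,11) by fastforce
    then have "j \<le> card {a \<in> A. {a, b} \<in> E}" using assms(14) by blast
    also have "\<dots> \<le> card A"
      using finV assms(7) by (intro card_mono) (auto intro: finite_subset)
    finally show ?thesis using assms(8) by simp
  qed
  \<comment> \<open>Here \<open>n < r + s\<close> makes \<open>s + r - n\<close> exact; in the next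
    step it makes the divisor positive.\<close>
  then have "real (card F) * (real r + real s - real n) \<le> real r * (real s - real j)"
    using of_nat_mono[OF bound, where 'a = real] assms(5) by (simp add: of_nat_diff add.commute)
  then have "real (card F) \<le> real r * (real s - real j) / (real r + real s - real n)"
    using assms(5) by (simp add: pos_le_divide_eq)
  then show ?thesis
    unfolding cardF by (simp add: le_floor_iff)
qed

end
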